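(* Let $k,n\ge1$ be integers. Fix a set $\mathcal O=\{S(1),\dots,S(t)\}$ where each $S(i)$ is a vector of length $k$ whose entries are subsets of $\{1,\dots,n\}$, $S(i)\ne(\emptyset,\dots,\emptyset)$, and all the non-empty entries of $S(1),\dots,S(t)$ are mutually disjoint with union a subset of $\{2,\dots,n\}$. Then the vectors $(\#1(\pi),\dots,\#k(\pi))$ and $(\#(\ell(\pi)k-k+1)(\pi),\dots,\#(\ell(\pi)k)(\pi))$ have a symmetric joint distribution over all $(k,k)$-parking functions $\pi\in\mathrm{PF}(k,k,n)$ with $\mathcal O(\pi)=\mathcal O$; that is, for all $u,v\in\mathbb Z_{\ge0}^k$, the number of such $\pi$ for which the first vector is $u$ and the second is $v$ equals the number of such $\pi$ for which the first vector is $v$ and the second is $u$.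
   Context: $\mathrm{PF}(k,k,n)$ is the set of $(k,k)$-parking functions of length $n$: sequences $\pi=(\pi_1,\dots,\pi_n)$ of positive integers whose weakly increasing rearrangement $\lambda_1\le\cdots\le\lambda_n$ satisfies $\lambda_i\le ik$ for $1\le i\le n$. Let $B_\pi(x)=\{j:\pi_j=x\}$ and $\#x(\pi)=|B_\pi(x)|$, and let $\ell(\pi)=\lceil\pi_1/k\rceil$. For each index $i\in\{1,\dots,n\}$ let $S_\pi(i)=(B_\pi(ik-k+1),B_\pi(ik-k+2),\dots,B_\pi(ik))$, and let $\mathcal O(\pi)=\{S_\pi(i): i\ne 1,\ i\neq\ell(\pi),\ S_\pi(i)\ne(\emptyset,\dots,\emptyset)\}$. *)

theory Defs
  imports Complex_Main
begin

text \<open>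
  A sequence \<open>\<pi> = (\<pi>\<^sub>1, \<dots>, \<pi>\<^sub>n)\<close> is a list of length \<open>n\<close>. List positions count from 0,
  so \<open>\<pi>\<^sub>j\<close> is \<open>\<pi> ! (j - 1)\<close> for \<open>1 \<le> j \<le> n\<close>.
\<close>

definition PF :: "nat \<Rightarrow> nat \<Rightarrow> nat list set" where
  "PF k n = {\<pi>. length \<pi> = n \<and> (\<forall>x\<in>set \<pi>. 1 \<le> x) \<and>
                 (\<forall>i\<in>{1..n}. sort \<pi> ! (i - 1) \<le> i * k)}"

definition B :: "nat list \<Rightarrow> nat \<Rightarrow> nat set" where
  "B \<pi> x = {j \<in> {1..length \<pi>}. \<pi> ! (j - 1) = x}"

definition num :: "nat list \<Rightarrow> nat \<Rightarrow> nat" where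
  "num \<pi> x = card (B \<pi> x)"

definition ell :: "nat \<Rightarrow> nat list \<Rightarrow> nat" where
  "ell k \<pi> = nat \<lceil>real (\<pi> ! 0) / real k\<rceil>"

text \<open>
  Vectors of length \<open>k\<close> are lists. The \<open>i\<close>-th block, \<open>i \<ge> 1\<close>, consists of the values
  \<open>ik - k + 1, \<dots>, ik\<close>; the subtraction on \<^typ>\<open>nat\<close> does not truncate there.
\<close>

definition block :: "nat \<Rightarrow> nat \<Rightarrow> nat list" where
  "block k i = [i * k - k + 1 ..< i * k + 1]"

definition S :: "nat \<Rightarrow> nat list \<Rightarrow> nat \<Rightarrow> nat set list" where
  "S k \<pi> i = map (B \<pi>) (block k i)"

definition num_vec :: "nat \<Rightarrow> nat list \<Rightarrow> nat \<Rightarrow> nat list" where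
  "num_vec k \<pi> i = map (num \<pi>) (block k i)"

definition Oset :: "nat \<Rightarrow> nat list \<Rightarrow> nat set list set" where
  "Oset k \<pi> = {S k \<pi> i | i. i \<in> {1..length \<pi>} \<and> i \<noteq> 1 \<and> i \<noteq> ell k \<pi> \<and>
                              S k \<pi> i \<noteq> replicate k {}}"

text \<open>
  Disjointness is between entries at different places, whether in the same vector or in two
  different ones; for empty entries the condition is vacuous.
\<close>

definition admissible :: "nat \<Rightarrow> nat \<Rightarrow> nat set list set \<Rightarrow> bool" where
  "admissible k n \<O> \<longleftrightarrow>
     finite \<O> \<and>
     (\<forall>s\<in>\<O>. length s = k \<and> (\<forall>a<k. s ! a \<subseteq> {1..n}) \<and> s \<noteq> replicate k {}) \<and>
     (\<forall>s\<in>\<O>. \<forall>s'\<in>\<O>. \<forall>a<k. \<forall>b<k. (s, a) \<noteq> (s', b) \<longrightarrow> s ! a \<inter> s' ! b = {}) \<and>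
     (\<Union>s\<in>\<O>. \<Union>(set s)) \<subseteq> {2..n}"

end

theory Submission
  imports Defs "HOL-Library.Multiset" "HOL-Combinatorics.Transposition"
begin

text \<open>
  Call the indices \<open>1, \<dots>, n\<close> cars and let the block of car \<open>j\<close> be the \<open>i\<close> with
  \<open>ik - k < \<pi>\<^sub>j \<le> ik\<close>. Being a \<open>(k,k)\<close>-parking function depends only on the number
  of cars in each block: the blocks \<open>1, \<dots>, i\<close> must hold at least \<open>i\<close> cars in total, for every \<open>i \<le> n\<close>.
  If \<open>\<ell>(\<pi>) = 1\<close>, the two vectors coincide, so only the words with \<open>\<ell>(\<pi>) \<noteq> 1\<close> matter when \<open>u \<noteq> v\<close>.

  Forget the parking condition and let the cars occupy the blocks \<open>1, \<dots>, n + 1\<close>, one more than a parking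
  function can use. Let \<open>W(u,v)\<close> be the set of these words with \<open>\<ell> \<noteq> 1\<close>, vector \<open>u\<close> in block 1,
  vector \<open>v\<close> in block \<open>\<ell>\<close>, and the set \<open>\<O>\<close> of non-empty contents of the other blocks. The
  theorem follows from two facts on the set \<open>P(u,v)\<close> of pairs of a word in \<open>W(u,v)\<close> and a car in its
  block 1.

  \<^item> The \<open>n\<close> cyclic rotations of the blocks \<open>2, \<dots>, n + 1\<close> act on \<open>W(u,v)\<close>. By the cycle lemma
    (\<open>cycle_lemma\<close>), a word with \<open>a\<close> cars in block 1 is turned into a parking function by exactly \<open>a\<close> of
    them. Averaging over the rotations (\<open>count_parking\<close>),
    \<open>|P(u,v)|\<close> is \<open>n\<close> times the number of parking functions in \<open>W(u,v)\<close>.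

  \<^item> \<open>P(u,v)\<close> and \<open>P(v,u)\<close> are in bijection (\<open>exchange_pointed_configs\<close>): given a word and a car \<open>x\<close> in
    its block 1, exchange the contents of the blocks 1 and \<open>\<ell>\<close>, which moves car 1 into block 1, and then
    let car 1 and the car \<open>x\<close> trade places. Car 1 is back in block \<open>\<ell>\<close> and \<open>x\<close> is back in block 1, but
    the two vectors have been exchanged.
\<close>

section \<open>Blocks of values\<close>

definition block_of :: "nat \<Rightarrow> nat \<Rightarrow> nat" where
  "block_of k x = (x - 1) div k + 1"

text \<open>
  The places \<open>c\<close> inside a block are counted from 0.
\<close>

definition value_at :: "nat \<Rightarrow> nat \<Rightarrow> nat \<Rightarrow> nat" where
  "value_at k b c = (b - 1) * k + c + 1"

text \<open>
  A car moves from block \<open>b\<close> to block \<open>\<sigma> b\<close> and keeps its place inside the block, so that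
  the content of each block moves as a whole.
\<close>

definition permute_blocks :: "nat \<Rightarrow> (nat \<Rightarrow> nat) \<Rightarrow> nat \<Rightarrow> nat" where
  "permute_blocks k \<sigma> x = value_at k (\<sigma> (block_of k x)) ((x - 1) mod k)"

lemma block_of_pos: "1 \<le> block_of k x"
  by (simp add: block_of_def)

lemma block_of_value_at: "c < k \<Longrightarrow> 1 \<le> b \<Longrightarrow> block_of k (value_at k b c) = b"
  by (simp add: block_of_def value_at_def)

lemma mod_value_at: "c < k \<Longrightarrow> (value_at k b c - 1) mod k = c"
  by (simp add: value_at_def)

lemma value_at_block_of: "1 \<le> x \<Longrightarrow> value_at k (block_of k x) ((x - 1) mod k) = x"
  by (simp add: block_of_def value_at_def)

lemma block_of_le_iff: "1 \<le> k \<Longrightarrow> 1 \<le> x \<Longrightarrow> 1 \<le> i \<Longrightarrow> block_of k x \<le> i \<longleftrightarrow> x \<le> i * k"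
  using div_less_iff_less_mult[of k "x - 1" i] by (auto simp: block_of_def)

lemma block_of_permute_blocks:
  "1 \<le> k \<Longrightarrow> 1 \<le> \<sigma> (block_of k x) \<Longrightarrow> block_of k (permute_blocks k \<sigma> x) = \<sigma> (block_of k x)"
  by (simp add: permute_blocks_def block_of_value_at)

lemma permute_blocks_pos: "1 \<le> permute_blocks k \<sigma> x"
  by (simp add: permute_blocks_def value_at_def)

lemma permute_blocks_permute_blocks:
  "1 \<le> k \<Longrightarrow> 1 \<le> x \<Longrightarrow> 1 \<le> \<sigma> (block_of k x) \<Longrightarrow> \<tau> (\<sigma> (block_of k x)) = block_of k x
   \<Longrightarrow> permute_blocks k \<tau> (permute_blocks k \<sigma> x) = x"
  unfolding permute_blocks_def
  by (subst block_of_value_at, simp_all, subst mod_value_at[simplified], simp_all add: value_at_block_of[simplified])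

lemma block_eq_value_at: "1 \<le> i \<Longrightarrow> block k i = map (value_at k i) [0..<k]"
proof -
  assume "1 \<le> i"
  then obtain m where "i = Suc m" by (cases i) auto
  then show ?thesis
    by (intro nth_equalityI) (auto simp: block_def value_at_def simp del: upt_Suc)
qed

lemma ell_eq_block_of:
  assumes "1 \<le> k" "1 \<le> \<pi> ! 0"
  shows "ell k \<pi> = block_of k (\<pi> ! 0)"
proof -
  define x where "x = \<pi> ! 0"
  define q where "q = (x - 1) div k"
  define r where "r = (x - 1) mod k"
  have "x = q * k + r + 1" "r < k"
    using assms by (auto simp: q_def r_def x_def)
  then have "real x = real q * real k + real r + 1" "real r + 1 \<le> real k"
    by auto
  then have "\<lceil>real x / real k\<rceil> = int (q + 1)"
    using assms(1) by (intro ceiling_unique) (auto simp: field_simps)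
  then show ?thesis
    unfolding ell_def x_def[symmetric] block_of_def q_def[symmetric] by simp
qed

section \<open>Parking words\<close>

text \<open>
  In a sorted list the entries that are at most \<open>c\<close> form an initial segment.
\<close>

lemma sorted_nth_le_iff:
  "sorted xs \<Longrightarrow> i < length xs \<Longrightarrow> xs ! i \<le> (c::nat) \<longleftrightarrow> i < length (filter (\<lambda>x. x \<le> c) xs)"
proof (induction xs arbitrary: i)
  case (Cons a xs)
  show ?case
  proof (cases "a \<le> c")
    case True
    with Cons show ?thesis by (cases i) auto
  next
    case False
    then have "\<forall>x \<in> set (a # xs). \<not> x \<le> c"
      using Cons.prems(1) by auto
    moreover have "(a # xs) ! i \<in> set (a # xs)"
      using Cons.prems(2) nth_mem by blast
    ultimately show ?thesis
      by (metis filter_False less_nat_zero_code list.size(3))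
  qed
qed simp

text \<open>
  The parking condition in terms of blocks; \<open>PF_iff_parks\<close> links it to the rearrangement.
\<close>

definition parks :: "nat \<Rightarrow> nat list \<Rightarrow> bool" where
  "parks k \<pi> \<longleftrightarrow>
     (\<forall>i\<in>{1..length \<pi>}. i \<le> card {j. j < length \<pi> \<and> block_of k (\<pi> ! j) \<le> i})"

lemma PF_iff_parks:
  assumes "1 \<le> k"
  shows "\<pi> \<in> PF k n \<longleftrightarrow> length \<pi> = n \<and> (\<forall>x\<in>set \<pi>. 1 \<le> x) \<and> parks k \<pi>"
proof -
  have "sort \<pi> ! (i - 1) \<le> i * k
          \<longleftrightarrow> i \<le> card {j. j < length \<pi> \<and> block_of k (\<pi> ! j) \<le> i}"
    if pos: "\<forall>x\<in>set \<pi>. 1 \<le> x" and i: "i \<in> {1..length \<pi>}" for i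
  proof -
    have "sort \<pi> ! (i - 1) \<le> i * k \<longleftrightarrow> i - 1 < length (filter (\<lambda>x. x \<le> i * k) (sort \<pi>))"
      using i by (intro sorted_nth_le_iff) auto
    also have "length (filter (\<lambda>x. x \<le> i * k) (sort \<pi>)) = length (filter (\<lambda>x. x \<le> i * k) \<pi>)"
      by (metis mset_filter mset_sort size_mset)
    also have "\<dots> = card {j. j < length \<pi> \<and> \<pi> ! j \<le> i * k}"
      by (rule length_filter_conv_card)
    also have "{j. j < length \<pi> \<and> \<pi> ! j \<le> i * k} = {j. j < length \<pi> \<and> block_of k (\<pi> ! j) \<le> i}"
      using pos i block_of_le_iff[OF assms] by auto
    finally show ?thesis using i by auto
  qed
  then show ?thesis
    unfolding PF_def parks_def by auto
qed

section \<open>The cycle lemma\<close>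

text \<open>
  Read \<open>f\<close> periodically and let the walk \<open>H\<close> rise by \<open>1 - f m\<close> in step \<open>m\<close>. It gains \<open>a\<close> in each period,
  and the inequalities for the rotation by \<open>r\<close> say that \<open>H (r + n)\<close> exceeds all earlier values, that is,
  that \<open>r + n\<close> is a record time. Since the walk rises by at most 1 per step, its running maximum \<open>M\<close>
  rises by exactly 1 at each record, so the number of records in a period is the gain \<open>a\<close> of \<open>M\<close>.
\<close>

lemma cycle_lemma:
  fixes f :: "nat \<Rightarrow> nat"
  assumes n: "1 \<le> n" and total: "a + (\<Sum>j<n. f j) = n"
  shows "card {r. r < n \<and> (\<forall>i<n. i < a + (\<Sum>j<i. f ((j + r) mod n)))} = a"
proof -
  define H :: "nat \<Rightarrow> int" where "H m = int m - (\<Sum>j<m. int (f (j mod n)))" for m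
  define M where "M m = Max (H ` {..m})" for m
  have sum_shift: "(\<Sum>j<i. int (f ((j + r) mod n))) = int i - (H (r + i) - H r)" for r i
    by (induction i) (auto simp: H_def add.commute)
  have H_period: "H (m + n) = H m + int a" for m
  proof (induction m)
    case 0
    have "(\<Sum>j<n. int (f (j mod n))) = (\<Sum>j<n. int (f j))"
      by (rule sum.cong) auto
    then show ?case using total by (simp add: H_def flip: of_nat_sum)
  next
    case (Suc m)
    then show ?case by (simp add: H_def)
  qed
  have H_step: "H (Suc m) \<le> H m + 1" for m
    by (simp add: H_def)
  define rec where "rec m \<longleftrightarrow> (\<forall>j<m. H j < H m)" for m
  have M_ge: "H j \<le> M m" if "j \<le> m" for j m
    unfolding M_def using that by (intro Max_ge) auto
  have M_attained: "\<exists>j\<le>m. M m = H j" for m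
  proof -
    have "M m \<in> H ` {..m}" unfolding M_def by (intro Max_in) auto
    then show ?thesis by auto
  qed
  have M_Suc: "M (Suc m) = M m + (if rec (Suc m) then 1 else 0)" for m
  proof -
    have eq: "M (Suc m) = max (H (Suc m)) (M m)"
      unfolding M_def by (simp add: atMost_Suc)
    show ?thesis
    proof (cases "rec (Suc m)")
      case True
      have "M m < H (Suc m)"
        using M_attained[of m] True unfolding rec_def by (metis le_imp_less_Suc)
      moreover have "H (Suc m) \<le> M m + 1"
        using H_step[of m] M_ge[of m m] by simp
      ultimately show ?thesis using eq True by simp
    next
      case False
      then obtain j where "j \<le> m" "H (Suc m) \<le> H j"
        unfolding rec_def by (auto simp: less_Suc_eq_le not_less)
      with M_ge[of j m] show ?thesis using eq False by simp
    qed
  qed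
  have count: "int (card {m. p < m \<and> m \<le> p + d \<and> rec m}) = M (p + d) - M p" for p d
  proof (induction d)
    case 0
    have "{m. p < m \<and> m \<le> p + 0 \<and> rec m} = {}" by auto
    then show ?case by simp
  next
    case (Suc d)
    have fin: "finite {m. p < m \<and> m \<le> p + d \<and> rec m}" by simp
    have "{m. p < m \<and> m \<le> p + Suc d \<and> rec m}
        = (if rec (Suc (p + d)) then insert (Suc (p + d)) {m. p < m \<and> m \<le> p + d \<and> rec m}
           else {m. p < m \<and> m \<le> p + d \<and> rec m})"
      by (auto simp: le_Suc_eq)
    then show ?case using Suc fin M_Suc[of "p + d"] by simp
  qed
  \<comment> \<open>The window starts after \<open>n - 1\<close>, so that the maximum before it already covers a full period.\<close>
  have M_period: "M (n - 1 + n) = M (n - 1) + int a"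
  proof (rule antisym)
    obtain j where j: "j \<le> n - 1 + n" "M (n - 1 + n) = H j" using M_attained by blast
    show "M (n - 1 + n) \<le> M (n - 1) + int a"
    proof (cases "j < n")
      case True
      then have "j \<le> n - 1" by simp
      then show ?thesis using M_ge[of j "n - 1"] j by simp
    next
      case False
      then have "H j = H (j - n) + int a" using H_period[of "j - n"] by simp
      then show ?thesis using M_ge[of "j - n" "n - 1"] j False by simp
    qed
    obtain i where i: "i \<le> n - 1" "M (n - 1) = H i" using M_attained by blast
    then show "M (n - 1) + int a \<le> M (n - 1 + n)"
      using H_period[of i] M_ge[of "i + n" "n - 1 + n"] by simp
  qed
  \<comment> \<open>Times before \<open>r\<close> add no condition: one period later, \<open>H\<close> is at least as high.\<close>
  have good: "(\<forall>i<n. i < a + (\<Sum>j<i. f ((j + r) mod n))) \<longleftrightarrow> rec (r + n)" if "r < n" for r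
  proof -
    have "(i < a + (\<Sum>j<i. f ((j + r) mod n))) \<longleftrightarrow> H (r + i) < H (r + n)" for i
    proof -
      have "(i < a + (\<Sum>j<i. f ((j + r) mod n)))
          \<longleftrightarrow> int i < int a + (\<Sum>j<i. int (f ((j + r) mod n)))"
        by (simp flip: of_nat_sum of_nat_add)
      then show ?thesis using sum_shift[of r i] H_period[of r] by (simp, arith)
    qed
    moreover have "(\<forall>i<n. H (r + i) < H (r + n)) \<longleftrightarrow> rec (r + n)"
    proof
      assume *: "\<forall>i<n. H (r + i) < H (r + n)"
      have later: "H j < H (r + n)" if "r \<le> j" "j < r + n" for j
        using *[rule_format, of "j - r"] that by simp
      have "H j < H (r + n)" if "j < r" for j
        using later[of "j + n"] H_period[of j] that \<open>r < n\<close> by simp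
      with later show "rec (r + n)" unfolding rec_def by (meson not_less)
    qed (auto simp: rec_def)
    ultimately show ?thesis by simp
  qed
  have "{m. n - 1 < m \<and> m \<le> n - 1 + n \<and> rec m}
      = (\<lambda>r. r + n) ` {r. r < n \<and> (\<forall>i<n. i < a + (\<Sum>j<i. f ((j + r) mod n)))}"
    (is "?L = _ ` ?R")
  proof (intro equalityI subsetI)
    fix m assume "m \<in> ?L"
    then have "m - n < n" "rec (m - n + n)" "m = m - n + n" using n by auto
    with good show "m \<in> (\<lambda>r. r + n) ` ?R" by blast
  qed (use n good in auto)
  then have "card ?L = card ?R"
    by (simp add: card_image)
  then show ?thesis
    using count[of "n - 1" n] M_period by simp
qed


section \<open>Permuting the blocks\<close>

text \<open>
  The values run through \<open>n + 1\<close> blocks, so that \<open>n\<close> blocks besides the first can be rotated.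
\<close>

definition words :: "nat \<Rightarrow> nat \<Rightarrow> nat list set" where
  "words k n = {\<pi>. length \<pi> = n \<and> (\<forall>x\<in>set \<pi>. 1 \<le> x \<and> x \<le> (n + 1) * k)}"

text \<open>
  The analogue of \<open>Oset\<close> for words that may use the block \<open>n + 1\<close>; the two agree on parking
  functions (\<open>parking_words\<close>).
\<close>

definition other_blocks :: "nat \<Rightarrow> nat list \<Rightarrow> nat set list set" where
  "other_blocks k \<pi> = S k \<pi> ` ({1..length \<pi> + 1} - {1, ell k \<pi>}) - {replicate k {}}"

text \<open>
  The set \<open>W(u,v)\<close> of the introduction.
\<close>

definition configs :: "nat \<Rightarrow> nat \<Rightarrow> nat set list set \<Rightarrow> nat list \<Rightarrow> nat list \<Rightarrow> nat list set" where
  "configs k n \<O> u v = {\<pi> \<in> words k n. ell k \<pi> \<noteq> 1 \<and> other_blocks k \<pi> = \<O> \<and>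
                        num_vec k \<pi> 1 = u \<and> num_vec k \<pi> (ell k \<pi>) = v}"

lemma finite_configs: "finite (configs k n \<O> u v)"
proof (rule finite_subset)
  show "configs k n \<O> u v \<subseteq> {\<pi>. set \<pi> \<subseteq> {..(n + 1) * k} \<and> length \<pi> = n}"
    by (auto simp: configs_def words_def)
qed (simp add: finite_lists_length_eq)

lemma words_block_of:
  "1 \<le> k \<Longrightarrow> \<pi> \<in> words k n \<longleftrightarrow>
     length \<pi> = n \<and> (\<forall>x\<in>set \<pi>. 1 \<le> x \<and> block_of k x \<in> {1..n + 1})"
  unfolding words_def using block_of_le_iff[of k _ "n + 1"] block_of_pos by auto

lemma words_nth:
  assumes "1 \<le> k" "\<pi> \<in> words k n" "j < n"
  shows "1 \<le> \<pi> ! j" "block_of k (\<pi> ! j) \<in> {1..n + 1}"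
  using assms by (auto simp: words_block_of)

lemma map_permute_blocks_words:
  assumes "1 \<le> k" "\<pi> \<in> words k n" "bij_betw \<sigma> {1..n + 1} {1..n + 1}"
  shows "map (permute_blocks k \<sigma>) \<pi> \<in> words k n"
proof -
  have "\<sigma> (block_of k x) \<in> {1..n + 1}" if "x \<in> set \<pi>" for x
    using assms that by (metis bij_betwE words_block_of)
  then show ?thesis
    using assms by (auto simp: words_block_of block_of_permute_blocks permute_blocks_pos[simplified])
qed

lemma ell_map_permute_blocks:
  assumes "1 \<le> k" "1 \<le> n" "\<pi> \<in> words k n" "bij_betw \<sigma> {1..n + 1} {1..n + 1}"
  shows "ell k (map (permute_blocks k \<sigma>) \<pi>) = \<sigma> (ell k \<pi>)"
proof -
  have len: "0 < length \<pi>" using assms by (simp add: words_def)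
  have pos: "1 \<le> \<pi> ! 0" "block_of k (\<pi> ! 0) \<in> {1..n + 1}"
    using words_nth[OF assms(1,3), of 0] assms(2) by auto
  then have "\<sigma> (block_of k (\<pi> ! 0)) \<in> {1..n + 1}"
    using assms(4) bij_betwE by blast
  then show ?thesis
    using len pos assms(1) by (simp add: ell_eq_block_of permute_blocks_pos[simplified] block_of_permute_blocks)
qed

lemma eq_value_at_iff:
  "1 \<le> x \<Longrightarrow> 1 \<le> i \<Longrightarrow> c < k \<Longrightarrow> x = value_at k i c \<longleftrightarrow> block_of k x = i \<and> (x - 1) mod k = c"
  using block_of_value_at mod_value_at value_at_block_of by metis

text \<open>
  Everything that \<open>configs\<close> speaks about is expressed by the vectors \<open>S\<close>, hence this transport of
  \<open>S\<close> along a permutation of the blocks determines the effect of rotations and of the exchange.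
\<close>

lemma S_map_permute_blocks:
  assumes "1 \<le> k" "\<pi> \<in> words k n" "bij_betw \<sigma> {1..n + 1} {1..n + 1}" "i \<in> {1..n + 1}"
  shows "S k (map (permute_blocks k \<sigma>) \<pi>) (\<sigma> i) = S k \<pi> i"
proof -
  have \<sigma>i: "\<sigma> i \<in> {1..n + 1}" using assms bij_betwE by blast
  have *: "permute_blocks k \<sigma> x = value_at k (\<sigma> i) c \<longleftrightarrow> x = value_at k i c" if "x \<in> set \<pi>" "c < k" for x c
  proof -
    have x: "1 \<le> x" "block_of k x \<in> {1..n + 1}" using assms that words_block_of by auto
    then have "\<sigma> (block_of k x) \<in> {1..n + 1}" using assms bij_betwE by blast
    then have "permute_blocks k \<sigma> x = value_at k (\<sigma> i) c \<longleftrightarrow> \<sigma> (block_of k x) = \<sigma> i \<and> (x - 1) mod k = c"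
      using \<sigma>i that assms(1) x
      by (subst eq_value_at_iff) (auto simp: permute_blocks_pos[simplified] block_of_permute_blocks, auto simp: permute_blocks_def value_at_def)
    also have "\<sigma> (block_of k x) = \<sigma> i \<longleftrightarrow> block_of k x = i"
      using assms(3,4) x(2) by (meson bij_betw_imp_inj_on inj_on_eq_iff)
    finally show ?thesis using eq_value_at_iff[of x i c k] x assms(4) that by simp
  qed
  have "B (map (permute_blocks k \<sigma>) \<pi>) (value_at k (\<sigma> i) c) = B \<pi> (value_at k i c)" if "c < k" for c
  proof -
    have "map (permute_blocks k \<sigma>) \<pi> ! (j - 1) = value_at k (\<sigma> i) c \<longleftrightarrow> \<pi> ! (j - 1) = value_at k i c"
      if "j \<in> {1..length \<pi>}" for j
    proof -
      have "j - 1 < length \<pi>" using that by auto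
      then show ?thesis using *[OF nth_mem \<open>c < k\<close>] by (simp only: nth_map)
    qed
    then show ?thesis by (auto simp: B_def)
  qed
  then show ?thesis
    using \<sigma>i assms(4) by (simp add: S_def block_eq_value_at)
qed

lemma num_vec_eq: "num_vec k \<pi> i = map card (S k \<pi> i)"
  by (simp add: num_vec_def S_def num_def)

text \<open>
  The index \<open>e\<close> is left free because in a rotation it is the new block of car 1,
  while in the exchange it is the old one.
\<close>

lemma other_blocks_map_permute_blocks:
  assumes "1 \<le> k" "1 \<le> n" "\<pi> \<in> words k n" "bij_betw \<sigma> {1..n + 1} {1..n + 1}"
    and "\<sigma> ` {1, ell k \<pi>} = {1, e}" "ell k \<pi> \<in> {1..n + 1}"
  shows "S k (map (permute_blocks k \<sigma>) \<pi>) ` ({1..n + 1} - {1, e}) - {replicate k {}} = other_blocks k \<pi>"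
proof -
  have len: "length \<pi> = n" using assms by (simp add: words_def)
  have "{1..n + 1} - {1, e} = \<sigma> ` ({1..n + 1} - {1, ell k \<pi>})"
    using assms(4,5,6) by (subst inj_on_image_set_diff[of \<sigma> "{1..n + 1}"])
      (auto simp: bij_betw_def)
  then have "S k (map (permute_blocks k \<sigma>) \<pi>) ` ({1..n + 1} - {1, e})
      = S k \<pi> ` ({1..n + 1} - {1, ell k \<pi>})"
    using S_map_permute_blocks[OF assms(1,3,4)] by (simp add: image_image)
  then show ?thesis by (simp add: other_blocks_def len)
qed

lemma ell_words:
  assumes "1 \<le> k" "1 \<le> n" "\<pi> \<in> words k n"
  shows "ell k \<pi> = block_of k (\<pi> ! 0)" "ell k \<pi> \<in> {1..n + 1}"
  using words_nth[OF assms(1,3), of 0] assms by (auto simp: ell_eq_block_of)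

section \<open>Rotations\<close>

text \<open>
  Rotation by \<open>s\<close> of the blocks \<open>2, \<dots>, n + 1\<close>.
\<close>

definition rotate_index :: "nat \<Rightarrow> nat \<Rightarrow> nat \<Rightarrow> nat" where
  "rotate_index n s b = (if b = 1 then 1 else 2 + (b - 2 + s) mod n)"

lemma rotate_index_range: "1 \<le> n \<Longrightarrow> rotate_index n s b \<in> {1..n + 1}"
  by (auto simp: rotate_index_def Suc_le_eq less_Suc_eq_le)

lemma rotate_index_rotate_index:
  assumes "b \<in> {1..n + 1}" "s + t = n"
  shows "rotate_index n s (rotate_index n t b) = b"
proof (cases "b = 1")
  case False
  then have b: "b - 2 < n" "2 \<le> b" using assms by auto
  have "((b - 2 + t) mod n + s) mod n = (b - 2 + (s + t)) mod n"
    unfolding mod_add_left_eq by (simp add: ac_simps)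
  also have "\<dots> = b - 2"
    using b(1) by (simp only: assms(2) mod_add_self2 mod_less)
  finally show ?thesis using False b(2) by (simp add: rotate_index_def)
qed (simp add: rotate_index_def)

lemma bij_betw_rotate_index:
  assumes "1 \<le> n" "s \<le> n"
  shows "bij_betw (rotate_index n s) {1..n + 1} {1..n + 1}"
proof (rule bij_betw_byWitness[where f' = "rotate_index n (n - s)"])
  show "\<forall>b\<in>{1..n + 1}. rotate_index n (n - s) (rotate_index n s b) = b"
       "\<forall>b\<in>{1..n + 1}. rotate_index n s (rotate_index n (n - s) b) = b"
    using rotate_index_rotate_index assms(2) by auto
qed (use rotate_index_range[OF assms(1)] in blast)+

lemma map_permute_blocks_inverse:
  assumes "1 \<le> k" "\<pi> \<in> words k n" "\<And>b. b \<in> {1..n + 1} \<Longrightarrow> \<tau> (\<sigma> b) = b"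
    and "bij_betw \<sigma> {1..n + 1} {1..n + 1}"
  shows "map (permute_blocks k \<tau>) (map (permute_blocks k \<sigma>) \<pi>) = \<pi>"
proof -
  have "permute_blocks k \<tau> (permute_blocks k \<sigma> x) = x" if "x \<in> set \<pi>" for x
  proof -
    have "1 \<le> x" "block_of k x \<in> {1..n + 1}" using assms that words_block_of by auto
    moreover from this have "\<sigma> (block_of k x) \<in> {1..n + 1}" using assms bij_betwE by blast
    ultimately show ?thesis using assms by (intro permute_blocks_permute_blocks) auto
  qed
  then show ?thesis by (simp add: map_idI)
qed

lemma rotate_index_configs:
  assumes "1 \<le> k" "1 \<le> n" "s \<le> n" "\<pi> \<in> configs k n \<O> u v"
  shows "map (permute_blocks k (rotate_index n s)) \<pi> \<in> configs k n \<O> u v"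
proof -
  let ?\<pi>' = "map (permute_blocks k (rotate_index n s)) \<pi>"
  note bij = bij_betw_rotate_index[OF assms(2,3)]
  have w: "\<pi> \<in> words k n" and l1: "ell k \<pi> \<noteq> 1" using assms(4) by (auto simp: configs_def)
  note e = ell_words(2)[OF assms(1,2) w]
  have ell: "ell k ?\<pi>' = rotate_index n s (ell k \<pi>)" by (rule ell_map_permute_blocks[OF assms(1,2) w bij])
  have one: "rotate_index n s 1 = 1" by (simp add: rotate_index_def)
  have "other_blocks k ?\<pi>' = other_blocks k \<pi>"
    using other_blocks_map_permute_blocks[OF assms(1,2) w bij _ e, of "rotate_index n s (ell k \<pi>)"] one ell w
    by (simp add: other_blocks_def words_def)
  moreover have "num_vec k ?\<pi>' 1 = num_vec k \<pi> 1"
    using S_map_permute_blocks[OF assms(1) w bij, of 1] one by (simp add: num_vec_eq)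
  moreover have "num_vec k ?\<pi>' (ell k ?\<pi>') = num_vec k \<pi> (ell k \<pi>)"
    using S_map_permute_blocks[OF assms(1) w bij e] ell by (simp add: num_vec_eq)
  moreover have "ell k ?\<pi>' \<noteq> 1" using ell l1 by (simp add: rotate_index_def)
  ultimately show ?thesis
    using assms(4) map_permute_blocks_words[OF assms(1) w bij] by (simp add: configs_def)
qed

lemma card_le_sum:
  fixes g :: "nat \<Rightarrow> nat"
  assumes "\<And>x. x < n \<Longrightarrow> 1 \<le> g x"
  shows "card {x. x < n \<and> g x \<le> Suc i}
       = card {x. x < n \<and> g x = 1} + (\<Sum>j<i. card {x. x < n \<and> g x = j + 2})"
proof (induction i)
  case 0
  have "{x. x < n \<and> g x \<le> Suc 0} = {x. x < n \<and> g x = 1}"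
    using assms by (auto simp: le_antisym)
  then show ?case by simp
next
  case (Suc i)
  have "{x. x < n \<and> g x \<le> Suc (Suc i)}
      = {x. x < n \<and> g x \<le> Suc i} \<union> {x. x < n \<and> g x = i + 2}"
    by auto
  moreover have "card ({x. x < n \<and> g x \<le> Suc i} \<union> {x. x < n \<and> g x = i + 2})
      = card {x. x < n \<and> g x \<le> Suc i} + card {x. x < n \<and> g x = i + 2}"
    by (rule card_Un_disjoint) auto
  ultimately show ?case using Suc by simp
qed

text \<open>
  The cycle lemma applied to the numbers of cars in the blocks: \<open>a\<close> cars in block 1 and \<open>f j\<close>
  in block \<open>j + 2\<close>. Rotating the blocks by \<open>n - r\<close> brings the content of block \<open>(j + r) mod n + 2\<close> to
  block \<open>j + 2\<close>, which is the indexing of that lemma.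
\<close>

lemma card_parking_rotations:
  assumes "1 \<le> k" "1 \<le> n" "\<pi> \<in> words k n"
  shows "card {r. r < n \<and> parks k (map (permute_blocks k (rotate_index n (n - r))) \<pi>)}
       = card {x. x < n \<and> block_of k (\<pi> ! x) = 1}"
proof -
  define a where "a = card {x. x < n \<and> block_of k (\<pi> ! x) = 1}"
  define f where "f j = card {x. x < n \<and> block_of k (\<pi> ! x) = j + 2}" for j
  have len: "length \<pi> = n" using assms(3) by (simp add: words_def)
  have "{x. x < n \<and> block_of k (\<pi> ! x) \<le> Suc n} = {..<n}"
    using words_nth(2)[OF assms(1,3)] by auto
  then have total: "a + (\<Sum>j<n. f j) = n"
    using card_le_sum[of n "\<lambda>x. block_of k (\<pi> ! x)" n] block_of_pos by (simp add: a_def f_def)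
  have "parks k (map (permute_blocks k (rotate_index n (n - r))) \<pi>)
      \<longleftrightarrow> (\<forall>i<n. i < a + (\<Sum>j<i. f ((j + r) mod n)))" if r: "r < n" for r
  proof -
    define g where "g x = rotate_index n (n - r) (block_of k (\<pi> ! x))" for x
    have block_of_g: "block_of k (map (permute_blocks k (rotate_index n (n - r))) \<pi> ! x) = g x" if "x < n" for x
      using that len assms rotate_index_range[of n "n - r"] by (simp add: g_def block_of_permute_blocks)
    have g_iff: "g x = b \<longleftrightarrow> block_of k (\<pi> ! x) = rotate_index n r b" if "x < n" "b \<in> {1..n + 1}" for x b
      using that words_nth(2)[OF assms(1,3)]
        rotate_index_rotate_index[of _ n r "n - r"] rotate_index_rotate_index[of _ n "n - r" r] r
      unfolding g_def by (metis add.commute le_add_diff_inverse less_imp_le)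
    have "card {x. x < n \<and> g x \<le> Suc i} = a + (\<Sum>j<i. f ((j + r) mod n))" if "i < n" for i
    proof -
      have "{x. x < n \<and> g x = 1} = {x. x < n \<and> block_of k (\<pi> ! x) = 1}"
        using g_iff[of _ 1] by (auto simp: rotate_index_def)
      moreover have "card {x. x < n \<and> g x = j + 2} = f ((j + r) mod n)" if "j < i" for j
        using g_iff[of _ "j + 2"] that \<open>i < n\<close>
        by (auto simp: rotate_index_def f_def intro!: arg_cong[of _ _ card])
      moreover have "1 \<le> g x" for x
        using rotate_index_range[OF assms(2)] by (simp add: g_def)
      ultimately show ?thesis
        using card_le_sum[of n g i] by (simp add: a_def)
    qed
    moreover have "parks k (map (permute_blocks k (rotate_index n (n - r))) \<pi>)
        \<longleftrightarrow> (\<forall>i\<in>{1..n}. i \<le> card {x. x < n \<and> g x \<le> i})"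
      using block_of_g len by (simp add: parks_def cong: conj_cong)
    moreover have "\<dots> \<longleftrightarrow> (\<forall>i<n. Suc i \<le> card {x. x < n \<and> g x \<le> Suc i})"
      by (subst image_Suc_lessThan[symmetric]) auto
    ultimately show ?thesis by (simp add: Suc_le_eq)
  qed
  then have "{r. r < n \<and> parks k (map (permute_blocks k (rotate_index n (n - r))) \<pi>)}
      = {r. r < n \<and> (\<forall>i<n. i < a + (\<Sum>j<i. f ((j + r) mod n)))}"
    by auto
  then show ?thesis
    using cycle_lemma[OF assms(2) total] by (simp add: a_def)
qed

text \<open>
  Count the pairs of a word and a rotation that makes it park. Each word has as many such rotations
  as cars in block 1; each rotation permutes \<open>configs\<close>, hence has as many such words
  as there are parking words.
\<close>

lemma count_parking:
  assumes "1 \<le> k" "1 \<le> n"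
  shows "n * card {\<pi> \<in> configs k n \<O> u v. parks k \<pi>}
       = (\<Sum>\<pi>\<in>configs k n \<O> u v. card {x. x < n \<and> block_of k (\<pi> ! x) = 1})"
proof -
  let ?C = "configs k n \<O> u v"
  let ?rot = "\<lambda>s. map (permute_blocks k (rotate_index n s))"
  have "card {\<pi> \<in> ?C. parks k (?rot (n - r) \<pi>)} = card {\<pi> \<in> ?C. parks k \<pi>}" if "r < n" for r
  proof (rule bij_betw_same_card[of "?rot (n - r)"],
      rule bij_betw_byWitness[where f' = "?rot r"])
    have inv: "?rot s (?rot t \<pi>) = \<pi>" if "s + t = n" "\<pi> \<in> ?C" for s t \<pi>
      using that assms by (intro map_permute_blocks_inverse[of k _ n] bij_betw_rotate_index rotate_index_rotate_index)
        (auto simp: configs_def)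
    show "\<forall>\<pi>\<in>{\<pi> \<in> ?C. parks k (?rot (n - r) \<pi>)}. ?rot r (?rot (n - r) \<pi>) = \<pi>"
         "\<forall>\<pi>\<in>{\<pi> \<in> ?C. parks k \<pi>}. ?rot (n - r) (?rot r \<pi>) = \<pi>"
      using that inv[of r "n - r"] inv[of "n - r" r] by auto
    show "?rot (n - r) ` {\<pi> \<in> ?C. parks k (?rot (n - r) \<pi>)} \<subseteq> {\<pi> \<in> ?C. parks k \<pi>}"
      using rotate_index_configs[OF assms, of "n - r"] by auto
    show "?rot r ` {\<pi> \<in> ?C. parks k \<pi>} \<subseteq> {\<pi> \<in> ?C. parks k (?rot (n - r) \<pi>)}"
      using rotate_index_configs[OF assms, of r] inv[of "n - r" r] that by fastforce
  qed
  then have "(\<Sum>\<pi>\<in>?C. card {r \<in> {..<n}. parks k (?rot (n - r) \<pi>)})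
      = (\<Sum>r<n. card {\<pi> \<in> ?C. parks k \<pi>})"
    by (intro sum_multicount_gen) (auto simp: finite_configs)
  moreover have "card {r \<in> {..<n}. parks k (?rot (n - r) \<pi>)} = card {x. x < n \<and> block_of k (\<pi> ! x) = 1}"
    if "\<pi> \<in> ?C" for \<pi>
    using card_parking_rotations[OF assms, of \<pi>] that by (simp add: configs_def)
  ultimately show ?thesis by simp
qed

section \<open>Exchanging the two distinguished blocks\<close>

text \<open>
  Car 1 of the informal numbering is the list position 0, and \<open>x\<close> is a list position too.
\<close>

definition swap_cars :: "nat \<Rightarrow> 'a list \<Rightarrow> 'a list" where
  "swap_cars x \<pi> = \<pi>[0 := \<pi> ! x, x := \<pi> ! 0]"

definition exchange :: "nat \<Rightarrow> nat list \<times> nat \<Rightarrow> nat list \<times> nat" where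
  "exchange k = (\<lambda>(\<pi>, x). (swap_cars x (map (permute_blocks k (transpose 1 (ell k \<pi>))) \<pi>), x))"

definition pointed_configs ::
  "nat \<Rightarrow> nat \<Rightarrow> nat set list set \<Rightarrow> nat list \<Rightarrow> nat list \<Rightarrow> (nat list \<times> nat) set" where
  "pointed_configs k n \<O> u v = (SIGMA \<pi>:configs k n \<O> u v. {x. x < n \<and> block_of k (\<pi> ! x) = 1})"

lemma length_swap_cars: "length (swap_cars x \<pi>) = length \<pi>"
  by (simp add: swap_cars_def)

lemma mset_swap_cars: "x < length \<pi> \<Longrightarrow> mset (swap_cars x \<pi>) = mset \<pi>"
  unfolding swap_cars_def by (rule mset_swap) auto

lemma nth_swap_cars:
  assumes "x < length \<pi>" "j < length \<pi>"
  shows "swap_cars x \<pi> ! j = (if j = 0 then \<pi> ! x else if j = x then \<pi> ! 0 else \<pi> ! j)"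
proof -
  have "0 < length \<pi>" using assms(1) by linarith
  then show ?thesis
    using assms unfolding swap_cars_def by (simp add: nth_list_update)
qed

lemma swap_cars_swap_cars: "x < length \<pi> \<Longrightarrow> swap_cars x (swap_cars x \<pi>) = \<pi>"
  by (rule nth_equalityI) (simp_all add: nth_swap_cars length_swap_cars del: length_greater_0_conv)

lemma map_swap_cars: "x < length \<pi> \<Longrightarrow> map g (swap_cars x \<pi>) = swap_cars x (map g \<pi>)"
  by (cases "\<pi> = []") (auto simp: swap_cars_def map_update)

lemma num_eq_count: "num \<pi> y = count (mset \<pi>) y"
proof -
  have "B \<pi> y = Suc ` {j. j < length \<pi> \<and> \<pi> ! j = y}"
    unfolding B_def
    by (intro equalityI subsetI, rule_tac x = "x - 1" in image_eqI) auto
  then have "num \<pi> y = card {j. j < length \<pi> \<and> \<pi> ! j = y}"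
    by (simp add: num_def card_image)
  also have "\<dots> = length (filter ((=) y) \<pi>)"
    by (simp add: length_filter_conv_card eq_commute[of y])
  finally show ?thesis by (simp add: count_mset count_list_eq_length_filter)
qed

lemma num_vec_swap_cars: "x < length \<pi> \<Longrightarrow> num_vec k (swap_cars x \<pi>) i = num_vec k \<pi> i"
  by (simp add: num_vec_def num_eq_count mset_swap_cars)

lemma S_swap_cars:
  assumes "1 \<le> k" "1 \<le> i" "x < length \<pi>" "block_of k (\<pi> ! 0) \<noteq> i" "block_of k (\<pi> ! x) \<noteq> i"
  shows "S k (swap_cars x \<pi>) i = S k \<pi> i"
proof -
  have "B (swap_cars x \<pi>) y = B \<pi> y" if "y \<noteq> \<pi> ! 0" "y \<noteq> \<pi> ! x" for y
  proof -
    have "swap_cars x \<pi> ! (j - 1) = y \<longleftrightarrow> \<pi> ! (j - 1) = y" if "j \<in> {1..length \<pi>}" for j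
      using \<open>y \<noteq> \<pi> ! 0\<close> \<open>y \<noteq> \<pi> ! x\<close> that assms(3) by (subst nth_swap_cars) auto
    then show ?thesis by (auto simp: B_def length_swap_cars)
  qed
  moreover have "value_at k i c \<noteq> \<pi> ! 0" "value_at k i c \<noteq> \<pi> ! x" if "c < k" for c
    using block_of_value_at[OF that assms(2)] assms(4,5) by metis+
  ultimately show ?thesis
    using assms(2) by (simp add: S_def block_eq_value_at)
qed

text \<open>
  Trading places with \<open>x\<close> affects only the blocks 1 and \<open>\<ell>\<close>, because these contain the two cars, and
  preserves the number of cars at each value. It restores \<open>\<ell>\<close>, which makes the
  operation its own inverse.
\<close>

lemma exchange_pointed_configs:
  assumes k: "1 \<le> k" and n: "1 \<le> n" and p: "p \<in> pointed_configs k n \<O> u v"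
  shows "exchange k p \<in> pointed_configs k n \<O> v u" "exchange k (exchange k p) = p"
proof -
  obtain \<pi> x where px: "p = (\<pi>, x)" by (cases p)
  then have C: "\<pi> \<in> configs k n \<O> u v" and x: "x < n" "block_of k (\<pi> ! x) = 1"
    using p by (auto simp: pointed_configs_def)
  have w: "\<pi> \<in> words k n" and l1: "ell k \<pi> \<noteq> 1" using C by (auto simp: configs_def)
  have len: "length \<pi> = n" using w by (simp add: words_def)
  define e where "e = ell k \<pi>"
  define \<sigma> where "\<sigma> = transpose 1 e"
  define \<rho> where "\<rho> = map (permute_blocks k \<sigma>) \<pi>"
  have e: "e \<in> {1..n + 1}" "block_of k (\<pi> ! 0) = e"
    using ell_words[OF k n w] by (auto simp: e_def)
  have bij: "bij_betw \<sigma> {1..n + 1} {1..n + 1}"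
    unfolding \<sigma>_def using e(1) n
    by (intro bij_betw_byWitness[where f' = "transpose 1 e"]) (auto simp: transpose_def)
  have \<rho>w: "\<rho> \<in> words k n"
    unfolding \<rho>_def by (rule map_permute_blocks_words[OF k w bij])
  have \<rho>len: "length \<rho> = n" using len by (simp add: \<rho>_def)
  have \<rho>0: "block_of k (\<rho> ! 0) = 1" and \<rho>x: "block_of k (\<rho> ! x) = e"
    using len x n e k by (auto simp: \<rho>_def \<sigma>_def block_of_permute_blocks)
  define \<pi>' where "\<pi>' = swap_cars x \<rho>"
  have x0: "x \<noteq> 0" using x e l1 e_def by metis
  have w': "\<pi>' \<in> words k n"
    using \<rho>w mset_swap_cars[of x \<rho>] x \<rho>len
    by (simp add: words_def \<pi>'_def length_swap_cars) (metis set_mset_mset)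
  have nth': "\<pi>' ! 0 = \<rho> ! x" "\<pi>' ! x = \<rho> ! 0"
    using x x0 n \<rho>len by (auto simp: \<pi>'_def nth_swap_cars)
  have ell': "ell k \<pi>' = e"
    using ell_words(1)[OF k n w'] nth' \<rho>x by simp
  have "S k \<pi>' i = S k \<rho> i" if "i \<in> {1..n + 1} - {1, e}" for i
    unfolding \<pi>'_def using that x \<rho>len \<rho>0 \<rho>x k by (intro S_swap_cars) auto
  then have "other_blocks k \<pi>' = S k \<rho> ` ({1..n + 1} - {1, e}) - {replicate k {}}"
    using ell' w' by (auto simp: other_blocks_def words_def)
  also have "\<dots> = other_blocks k \<pi>"
    unfolding \<rho>_def using e(1) e_def \<sigma>_def
    by (intro other_blocks_map_permute_blocks[OF k n w bij]) auto
  finally have other_blocks': "other_blocks k \<pi>' = other_blocks k \<pi>" .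
  have "num_vec k \<pi>' (\<sigma> i) = num_vec k \<pi> i" if "i \<in> {1..n + 1}" for i
    using num_vec_swap_cars[of x \<rho> k "\<sigma> i"] S_map_permute_blocks[OF k w bij that] x \<rho>len
    by (simp add: \<pi>'_def num_vec_eq \<rho>_def)
  from this[of 1] this[of e] have "num_vec k \<pi>' e = num_vec k \<pi> 1" "num_vec k \<pi>' 1 = num_vec k \<pi> e"
    using e n by (auto simp: \<sigma>_def)
  then have "\<pi>' \<in> configs k n \<O> v u"
    using C w' other_blocks' ell' l1 by (auto simp: configs_def e_def)
  moreover have ex: "exchange k p = (\<pi>', x)"
    by (simp add: exchange_def px \<pi>'_def \<rho>_def \<sigma>_def e_def)
  ultimately show "exchange k p \<in> pointed_configs k n \<O> v u"
    using x nth' \<rho>0 by (simp add: pointed_configs_def)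
  have "map (permute_blocks k \<sigma>) \<pi>' = swap_cars x (map (permute_blocks k \<sigma>) \<rho>)"
    using x \<rho>len by (simp add: \<pi>'_def map_swap_cars)
  also have "map (permute_blocks k \<sigma>) \<rho> = \<pi>"
    unfolding \<rho>_def by (rule map_permute_blocks_inverse[OF k w _ bij]) (simp add: \<sigma>_def)
  finally have "swap_cars x (map (permute_blocks k \<sigma>) \<pi>') = \<pi>"
    using x len by (simp add: swap_cars_swap_cars)
  moreover have "exchange k (\<pi>', x) = (swap_cars x (map (permute_blocks k \<sigma>) \<pi>'), x)"
    by (simp add: exchange_def ell' \<sigma>_def)
  ultimately show "exchange k (exchange k p) = p"
    by (simp add: ex[unfolded px] px)
qed

lemma card_parking_configs_symmetric:
  assumes "1 \<le> k" "1 \<le> n"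
  shows "card {\<pi> \<in> configs k n \<O> u v. parks k \<pi>} = card {\<pi> \<in> configs k n \<O> v u. parks k \<pi>}"
proof -
  have "card (pointed_configs k n \<O> u v) = card (pointed_configs k n \<O> v u)"
    using exchange_pointed_configs[OF assms]
    by (intro bij_betw_same_card[of "exchange k"] bij_betw_byWitness[where f' = "exchange k"]) auto
  moreover have "card (pointed_configs k n \<O> u v) = n * card {\<pi> \<in> configs k n \<O> u v. parks k \<pi>}" for u v
    unfolding count_parking[OF assms] pointed_configs_def by (rule card_SigmaI) (auto simp: finite_configs)
  ultimately show ?thesis using assms(2) by simp
qed

text \<open>
  The parking condition for \<open>i = n\<close> puts all \<open>n\<close> cars into the blocks \<open>1, \<dots>, n\<close>, so the block
  \<open>n + 1\<close> is empty and does not contribute to \<open>other_blocks\<close>.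
\<close>

lemma parking_words:
  assumes "1 \<le> k" "1 \<le> n" 
  shows "\<pi> \<in> PF k n \<longleftrightarrow> \<pi> \<in> words k n \<and> parks k \<pi>"
    and "\<pi> \<in> PF k n \<Longrightarrow> other_blocks k \<pi> = Oset k \<pi>"
proof -
  have small: "length \<pi> = n \<and> (\<forall>x\<in>set \<pi>. 1 \<le> x \<and> block_of k x \<le> n)" if "\<pi> \<in> PF k n"
  proof -
    have P: "length \<pi> = n" "\<forall>x\<in>set \<pi>. 1 \<le> x" "parks k \<pi>"
      using that PF_iff_parks[OF assms(1)] by auto
    then have "n \<le> card {j. j < n \<and> block_of k (\<pi> ! j) \<le> n}"
      using assms(2) by (auto simp: parks_def)
    then have "{j. j < n \<and> block_of k (\<pi> ! j) \<le> n} = {..<n}"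
      by (intro card_seteq) auto
    then have "\<forall>j<n. block_of k (\<pi> ! j) \<le> n" by auto
    with P show ?thesis by (auto simp: in_set_conv_nth)
  qed
  then show "\<pi> \<in> PF k n \<longleftrightarrow> \<pi> \<in> words k n \<and> parks k \<pi>"
    using PF_iff_parks[OF assms(1), of \<pi> n] words_block_of[OF assms(1), of \<pi> n] block_of_pos[of k] by fastforce
  assume PF: "\<pi> \<in> PF k n"
  have "B \<pi> (value_at k (n + 1) c) = {}" if "c < k" for c
  proof -
    have "value_at k (n + 1) c \<notin> set \<pi>"
      using small[OF PF] block_of_value_at[OF that, of "n + 1"] by fastforce
    then have "\<pi> ! (j - 1) \<noteq> value_at k (n + 1) c" if "j \<in> {1..length \<pi>}" for j
    proof -
      have "j - 1 < length \<pi>" using that by auto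
      with \<open>value_at k (n + 1) c \<notin> set \<pi>\<close> show ?thesis using nth_mem by metis
    qed
    then show ?thesis by (auto simp: B_def)
  qed
  then have "S k \<pi> (n + 1) = replicate k {}"
    by (simp add: S_def block_eq_value_at list_eq_iff_nth_eq)
  moreover have "{1..length \<pi> + 1} = insert (n + 1) {1..length \<pi>}"
    using small[OF PF] by auto
  ultimately show "other_blocks k \<pi> = Oset k \<pi>"
    unfolding other_blocks_def Oset_def by (auto simp: image_iff)
qed

theorem proposition8p2:
  fixes k n :: nat and \<O> :: "nat set list set" and u v :: "nat list"
  assumes "k \<ge> 1" and "n \<ge> 1"
    and "admissible k n \<O>"
    and "length u = k" and "length v = k"
  shows "card {\<pi> \<in> PF k n. Oset k \<pi> = \<O> \<and> num_vec k \<pi> 1 = u \<and> num_vec k \<pi> (ell k \<pi>) = v}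
       = card {\<pi> \<in> PF k n. Oset k \<pi> = \<O> \<and> num_vec k \<pi> 1 = v \<and> num_vec k \<pi> (ell k \<pi>) = u}"
proof (cases "u = v")
  case False
  have "{\<pi> \<in> PF k n. Oset k \<pi> = \<O> \<and> num_vec k \<pi> 1 = u \<and> num_vec k \<pi> (ell k \<pi>) = v}
      = {\<pi> \<in> configs k n \<O> u v. parks k \<pi>}" if "u \<noteq> v" for u v
    using that parking_words[OF assms(1,2)] by (auto simp: configs_def)
  with False show ?thesis
    using card_parking_configs_symmetric[OF assms(1,2)] by simp
qed simp

end
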